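(* Let $\mathbb{X}=\langle X,\{\rho_i:i\in I\}\rangle$ be a countable relational structure (i.e. $|X|=\omega$), let $\mathbb{P}(\mathbb{X})$ be the set of all $A\subseteq X$ such that the substructure of $\mathbb{X}$ with domain $A$ is isomorphic to $\mathbb{X}$, let $\mathbb{P}(\mathbb{X})\!\uparrow=\{A\subseteq X:\exists S\in\mathbb{P}(\mathbb{X})\ S\subseteq A\}$, and let $\mathcal{I}_{\mathbb{X}}=\{I\subseteq X:\neg\exists A\in\mathbb{P}(\mathbb{X})\ A\subseteq I\}$. Then: (a) $\mathbb{P}(\mathbb{X})$ is an analytic set; (b) $\mathbb{P}(\mathbb{X})\!\uparrow$ is an analytic set; (c) $\mathcal{I}_{\mathbb{X}}$ is a co-analytic set containing the ideal $\mathrm{Fin}_X$ of finite subsets of $X$; (d) the sets $\mathbb{P}(\mathbb{X})$ and $\mathbb{P}(\mathbb{X})\!\uparrow$ have the Baire property and each has size $1$, $\aleph_0$ or $\mathfrak{c}$.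
   Context: Subsets of the countable set $X$ (identified with $\omega$) are identified with their characteristic functions in the Cantor space $2^\omega$; a family of subsets is called analytic, co-analytic, having the Baire property, etc., iff the corresponding set of characteristic functions has that property in $2^\omega$. *)

theory Defs
  imports "HOL-Analysis.Analysis" "HOL-Library.Equipollence"
begin

section \<open>Relational structures\<close>

text \<open>A structure \<open>\<langle>X, {\<rho>\<^sub>i : i \<in> I}\<rangle>\<close>. The elements of \<open>X\<^sup>n\<close> are the lists
  of length \<open>n\<close> with entries in \<open>X\<close>. The index set is arbitrary, possibly uncountable.\<close>

record ('i, 'a) relstruct =
  dom_of :: "'a set"
  index_of :: "'i set"
  arity_of :: "'i \<Rightarrow> nat"
  rel_of :: "'i \<Rightarrow> 'a list set"

definition tuples :: "nat \<Rightarrow> 'a set \<Rightarrow> 'a list set" where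
  "tuples n X = {t. length t = n \<and> set t \<subseteq> X}"

definition relational_structure :: "('i, 'a) relstruct \<Rightarrow> bool" where
  "relational_structure \<X> \<longleftrightarrow>
     (\<forall>i \<in> index_of \<X>. rel_of \<X> i \<subseteq> tuples (arity_of \<X> i) (dom_of \<X>))"

definition substructure :: "('i, 'a) relstruct \<Rightarrow> 'a set \<Rightarrow> ('i, 'a) relstruct" where
  "substructure \<X> A = \<lparr>dom_of = A, index_of = index_of \<X>, arity_of = arity_of \<X>,
     rel_of = (\<lambda>i. rel_of \<X> i \<inter> tuples (arity_of \<X> i) A)\<rparr>"

definition isomorphic :: "('i, 'a) relstruct \<Rightarrow> ('i, 'b) relstruct \<Rightarrow> bool" where
  "isomorphic \<X> \<Y> \<longleftrightarrow>
     index_of \<X> = index_of \<Y> \<and>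
     (\<forall>i \<in> index_of \<X>. arity_of \<X> i = arity_of \<Y> i) \<and>
     (\<exists>f. bij_betw f (dom_of \<X>) (dom_of \<Y>) \<and>
        (\<forall>i \<in> index_of \<X>. \<forall>t \<in> tuples (arity_of \<X> i) (dom_of \<X>).
           t \<in> rel_of \<X> i \<longleftrightarrow> map f t \<in> rel_of \<Y> i))"

definition copies :: "('i, 'a) relstruct \<Rightarrow> 'a set set" where
  "copies \<X> = {A. A \<subseteq> dom_of \<X> \<and> isomorphic (substructure \<X> A) \<X>}"

definition copies_up :: "('i, 'a) relstruct \<Rightarrow> 'a set set" where
  "copies_up \<X> = {A. A \<subseteq> dom_of \<X> \<and> (\<exists>S \<in> copies \<X>. S \<subseteq> A)}"

definition copy_free :: "('i, 'a) relstruct \<Rightarrow> 'a set set" where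
  "copy_free \<X> = {J. J \<subseteq> dom_of \<X> \<and> \<not> (\<exists>A \<in> copies \<X>. A \<subseteq> J)}"


section \<open>Families of subsets as subsets of the Cantor space\<close>

text \<open>The type \<^typ>\<open>nat \<Rightarrow> bool\<close> carries the product topology of the discrete two-point
  space. An enumeration \<open>e\<close> (a bijection from \<open>\<omega>\<close> onto \<open>X\<close>) identifies \<open>X\<close> with \<open>\<omega>\<close>.\<close>

type_synonym cantor = "nat \<Rightarrow> bool"

definition char_fun :: "(nat \<Rightarrow> 'a) \<Rightarrow> 'a set \<Rightarrow> cantor" where
  "char_fun e A = (\<lambda>n. e n \<in> A)"

definition char_family :: "(nat \<Rightarrow> 'a) \<Rightarrow> 'a set set \<Rightarrow> cantor set" where
  "char_family e \<F> = char_fun e ` \<F>"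

text \<open>Analytic sets are the continuous images of Baire space \<open>\<omega>\<^sup>\<omega>\<close>,
  together with the empty set.\<close>

definition analytic_set :: "cantor set \<Rightarrow> bool" where
  "analytic_set S \<longleftrightarrow>
     S = {} \<or> (\<exists>f :: (nat \<Rightarrow> nat) \<Rightarrow> cantor. continuous_on UNIV f \<and> S = range f)"

definition coanalytic_set :: "cantor set \<Rightarrow> bool" where
  "coanalytic_set S \<longleftrightarrow> analytic_set (- S)"

definition nowhere_dense :: "'t::topological_space set \<Rightarrow> bool" where
  "nowhere_dense S \<longleftrightarrow> interior (closure S) = {}"

definition meager :: "'t::topological_space set \<Rightarrow> bool" where
  "meager S \<longleftrightarrow> (\<exists>N :: nat \<Rightarrow> 't set. (\<forall>n. nowhere_dense (N n)) \<and> S = (\<Union>n. N n))"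

definition baire_property :: "'t::topological_space set \<Rightarrow> bool" where
  "baire_property S \<longleftrightarrow> (\<exists>U. open U \<and> meager (sym_diff S U))"

definition size_1_aleph0_or_continuum :: "'b set \<Rightarrow> bool" where
  "size_1_aleph0_or_continuum S \<longleftrightarrow>
     card S = 1 \<or> S \<approx> (UNIV :: nat set) \<or> S \<approx> (UNIV :: real set)"

end

theory Submission
  imports Defs
begin

text \<open>With \<open>X\<close> identified with \<open>\<omega>\<close>, the self-embeddings of the structure form a closed subset of
  Baire space and the copies are their ranges. Since taking ranges is not continuous, a copy is
  coded by an embedding together with, for every point, its preimage or the information that there
  is none; these codes again form a closed set, on which reading off the range is continuous. A
  nonempty closed set is a retract of Baire space, so the copies, and likewise their supersets, form analytic sets. The Baire
  property and the alternative countable/continuum hold for all analytic sets, by a Souslin scheme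
  and a Cantor scheme respectively. A finite size other than 1 is excluded by iterating a
  non-surjective embedding.\<close>

text \<open>Together with the product instance this makes \<open>cantor\<close> second countable,
  which the Baire property argument requires.\<close>

instance bool :: second_countable_topology
proof
  have "open = generate_topology {{True}, {False}}"
  proof (intro ext iffI)
    fix S :: "bool set"
    have "\<And>b. generate_topology {{True}, {False}} {b :: bool}"
      by (rule generate_topology.Basis) auto
    then have "generate_topology {{True}, {False}} (\<Union>b\<in>S. {b})"
      by (intro generate_topology.UN) auto
    then show "generate_topology {{True}, {False}} S" by simp
  qed (rule open_discrete)
  then show "\<exists>B::bool set set. countable B \<and> open = generate_topology B"
    by (intro exI[of _ "{{True}, {False}}"]) auto
qed

section \<open>Meager sets\<close>

lemma nowhere_dense_subset: "nowhere_dense T \<Longrightarrow> S \<subseteq> T \<Longrightarrow> nowhere_dense S"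
  unfolding nowhere_dense_def by (metis closure_mono interior_mono subset_empty)

lemma meager_subset_Union:
  assumes "countable \<N>" "\<And>N. N \<in> \<N> \<Longrightarrow> nowhere_dense N" "S \<subseteq> \<Union>\<N>"
  shows "meager S"
proof -
  \<comment> \<open>Inserting \<open>{}\<close> makes the family nonempty, so that it can be
    enumerated; intersecting with \<open>S\<close> turns the cover into the equality that
    \<open>meager\<close> demands.\<close>
  define f where "f n = from_nat_into (insert {} \<N>) n \<inter> S" for n
  have "nowhere_dense (f n)" for n
  proof -
    have "from_nat_into (insert {} \<N>) n \<in> insert {} \<N>" by (rule from_nat_into) simp
    then have "nowhere_dense (from_nat_into (insert {} \<N>) n)"
      using assms(2) by (auto simp: nowhere_dense_def)
    then show ?thesis unfolding f_def by (rule nowhere_dense_subset) auto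
  qed
  moreover have "(\<Union>n. f n) = S"
  proof -
    have "range (from_nat_into (insert {} \<N>)) = insert {} \<N>"
      using assms(1) by (intro range_from_nat_into) auto
    then have "(\<Union>n. from_nat_into (insert {} \<N>) n) = \<Union>\<N>" by simp
    then show ?thesis
      using assms(3) unfolding f_def by (simp only: UN_simps Int_absorb1 Int_absorb2)
  qed
  ultimately show ?thesis unfolding meager_def by metis
qed

lemma meager_nowhere_dense: "nowhere_dense S \<Longrightarrow> meager S"
  by (rule meager_subset_Union[of "{S}"]) auto

lemma meager_subset:
  assumes "meager T" "S \<subseteq> T"
  shows "meager S"
proof -
  obtain N :: "nat \<Rightarrow> _" where "\<And>n. nowhere_dense (N n)" "T = (\<Union>n. N n)"
    using assms(1) unfolding meager_def by blast
  then show ?thesis using assms(2) by (intro meager_subset_Union[of "range N"]) auto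
qed

lemma meager_UN:
  assumes "countable I" "\<And>i. i \<in> I \<Longrightarrow> meager (A i)"
  shows "meager (\<Union>i\<in>I. A i)"
proof -
  obtain N :: "_ \<Rightarrow> nat \<Rightarrow> _"
    where N: "\<And>i n. i \<in> I \<Longrightarrow> nowhere_dense (N i n)" "\<And>i. i \<in> I \<Longrightarrow> A i = (\<Union>n. N i n)"
    using assms(2) unfolding meager_def by metis
  show ?thesis
    by (rule meager_subset_Union[of "\<Union>i\<in>I. range (N i)"]) (use assms(1) N in auto)
qed

lemma meager_Un: "meager S \<Longrightarrow> meager T \<Longrightarrow> meager (S \<union> T)"
  using meager_UN[of "{S, T}" "\<lambda>A. A"] by auto

text \<open>The difference is closed, and an open set inside it is an open subset of
  \<open>S\<close>, hence lies in \<open>interior S\<close> and is empty.\<close>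

lemma nowhere_dense_closed_diff_interior:
  assumes "closed S"
  shows "nowhere_dense (S - interior S)"
proof -
  have "closed (S - interior S)" using assms by (simp add: closed_Diff)
  moreover have "interior (S - interior S) = {}"
    using interior_maximal[OF _ open_interior, of "S - interior S" S]
      interior_subset[of "S - interior S"] by blast
  ultimately show ?thesis by (simp add: nowhere_dense_def)
qed

text \<open>Kuratowski's set of points at which \<open>A\<close> is locally of second category. It
  serves below as a closed hull of \<open>A\<close> modulo meager sets.\<close>

definition nonmeager_points :: "'t::topological_space set \<Rightarrow> 't set" where
  "nonmeager_points A = {x. \<forall>U. open U \<longrightarrow> x \<in> U \<longrightarrow> \<not> meager (A \<inter> U)}"

lemma closed_nonmeager_points: "closed (nonmeager_points A)"
  unfolding closed_def
proof (subst open_subopen, intro ballI)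
  fix x assume "x \<in> - nonmeager_points A"
  then obtain U where "open U" "x \<in> U" "meager (A \<inter> U)"
    unfolding nonmeager_points_def by blast
  then show "\<exists>T. open T \<and> x \<in> T \<and> T \<subseteq> - nonmeager_points A"
    unfolding nonmeager_points_def by blast
qed

text \<open>Off the closure \<open>A\<close> has empty, hence meager, trace. Continuity of a map can
  thus be used to locate the points of the hulls of its images.\<close>

lemma nonmeager_points_subset_closure: "nonmeager_points A \<subseteq> closure A"
proof
  fix x assume x: "x \<in> nonmeager_points A"
  show "x \<in> closure A"
  proof (rule ccontr)
    assume "x \<notin> closure A"
    moreover have "A \<inter> - closure A = {}" using closure_subset[of A] by blast
    moreover have "meager ({} :: 'a set)" by (rule meager_subset_Union[of "{}"]) auto
    ultimately show False
      using x unfolding nonmeager_points_def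
      by (auto dest!: spec[where x = "- closure A"])
  qed
qed

text \<open>Each point of the difference has a basic neighbourhood on which \<open>A\<close> is
  meager, and a countable base leaves only countably many such traces to unite.\<close>

lemma meager_diff_nonmeager_points:
  fixes A :: "'t::second_countable_topology set"
  shows "meager (A - nonmeager_points A)"
proof -
  obtain B :: "'t set set" where B: "countable B" "topological_basis B"
    using ex_countable_basis by blast
  have "A - nonmeager_points A \<subseteq> (\<Union>b\<in>{b \<in> B. meager (A \<inter> b)}. A \<inter> b)"
  proof
    fix x assume x: "x \<in> A - nonmeager_points A"
    then obtain U where U: "open U" "x \<in> U" "meager (A \<inter> U)"
      unfolding nonmeager_points_def by blast
    obtain b where "b \<in> B" "x \<in> b" "b \<subseteq> U"
      using topological_basisE[OF B(2) U(1,2)] by blast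
    moreover from this have "meager (A \<inter> b)" by (intro meager_subset[OF U(3)]) blast
    ultimately show "x \<in> (\<Union>b\<in>{b \<in> B. meager (A \<inter> b)}. A \<inter> b)" using x by blast
  qed
  moreover have "meager (\<Union>b\<in>{b \<in> B. meager (A \<inter> b)}. A \<inter> b)"
    using B(1) by (intro meager_UN) auto
  ultimately show ?thesis by (rule meager_subset[rotated])
qed

section \<open>Cylinders\<close>

definition cylinder :: "'b list \<Rightarrow> (nat \<Rightarrow> 'b) set" where
  "cylinder s = {x. map x [0..<length s] = s}"

lemma mem_cylinder_iff: "x \<in> cylinder s \<longleftrightarrow> (\<forall>i<length s. x i = s ! i)"
  unfolding cylinder_def list_eq_iff_nth_eq by simp

lemma mem_cylinder_map_iff: "y \<in> cylinder (map x [0..<k]) \<longleftrightarrow> (\<forall>i<k. y i = x i)"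
  by (simp add: mem_cylinder_iff)

lemma cylinder_Nil [simp]: "cylinder [] = UNIV"
  by (simp add: cylinder_def)

lemma cylinder_append_subset: "cylinder (s @ t) \<subseteq> cylinder s"
proof
  fix x assume "x \<in> cylinder (s @ t)"
  then have *: "\<forall>i<length (s @ t). x i = (s @ t) ! i" unfolding mem_cylinder_iff .
  show "x \<in> cylinder s"
    unfolding mem_cylinder_iff
  proof (intro allI impI)
    fix i assume "i < length s"
    then show "x i = s ! i" using *[rule_format, of i] by (simp add: nth_append)
  qed
qed

lemma cylinder_eq_UN: "cylinder s = (\<Union>n. cylinder (s @ [n]))"
proof
  show "cylinder s \<subseteq> (\<Union>n. cylinder (s @ [n]))"
  proof
    fix x assume "x \<in> cylinder s"
    then have "x \<in> cylinder (s @ [x (length s)])"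
      by (auto simp: mem_cylinder_iff nth_append less_Suc_eq)
    then show "x \<in> (\<Union>n. cylinder (s @ [n]))" by blast
  qed
qed (use cylinder_append_subset in blast)

text \<open>Fixing the coordinates listed in \<open>l\<close>, an open condition by discreteness,
  fixes \<open>map x l\<close>. All closedness proofs for sets of codes reduce to this form through
  the complement.\<close>

lemma open_map_Collect:
  fixes P :: "'b::discrete_topology list \<Rightarrow> bool"
  shows "open {x :: nat \<Rightarrow> 'b. P (map x l)}"
proof (subst open_subopen, intro ballI)
  fix x assume x: "x \<in> {x :: nat \<Rightarrow> 'b. P (map x l)}"
  define U where "U = (\<Inter>i\<in>set l. (\<lambda>y :: nat \<Rightarrow> 'b. y i) -` {x i})"
  have "open ((\<lambda>y :: nat \<Rightarrow> 'b. y i) -` {x i})" for i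
    by (intro open_vimage open_discrete continuous_on_product_coordinates)
  then have "open U" unfolding U_def by (intro open_INT) auto
  moreover have "map y l = map x l" if "y \<in> U" for y
    using that by (auto simp: U_def)
  then have "U \<subseteq> {x. P (map x l)}" using x by (metis (mono_tags, lifting) mem_Collect_eq subsetI)
  ultimately show "\<exists>T. open T \<and> x \<in> T \<and> T \<subseteq> {x. P (map x l)}"
    by (intro exI[of _ U]) (auto simp: U_def)
qed

lemma closed_map_Collect:
  fixes P :: "'b::discrete_topology list \<Rightarrow> bool"
  shows "closed {x :: nat \<Rightarrow> 'b. P (map x l)}"
  using open_map_Collect[of "\<lambda>t. \<not> P t" l] by (simp add: closed_def Compl_eq)

lemma open_cylinder: "open (cylinder s :: (nat \<Rightarrow> 'b::discrete_topology) set)"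
  unfolding cylinder_def by (rule open_map_Collect)

lemma open_contains_cylinder:
  fixes U :: "(nat \<Rightarrow> 'b::topological_space) set"
  assumes "open U" "x \<in> U"
  obtains k where "cylinder (map x [0..<k]) \<subseteq> U"
proof -
  obtain V where V: "finite {i. V i \<noteq> UNIV}" "x \<in> Pi\<^sub>E UNIV V" "Pi\<^sub>E UNIV V \<subseteq> U"
    using assms unfolding open_fun_def openin_product_topology_alt by auto
  \<comment> \<open>A basic open box restricts finitely many coordinates; \<open>k\<close> bounds
    them all.\<close>
  obtain k where k: "\<And>i. V i \<noteq> UNIV \<Longrightarrow> i < k"
    using finite_nat_set_iff_bounded[THEN iffD1, OF V(1)] by blast
  have "cylinder (map x [0..<k]) \<subseteq> Pi\<^sub>E UNIV V"
  proof
    fix y assume y: "y \<in> cylinder (map x [0..<k])"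
    have "y i \<in> V i" for i
    proof (cases "V i = UNIV")
      case False
      then have "y i = x i" using y k[of i] by (simp add: mem_cylinder_map_iff)
      then show ?thesis using V(2) by (simp add: PiE_mem)
    qed simp
    then show "y \<in> Pi\<^sub>E UNIV V" by (simp add: PiE_iff)
  qed
  then show ?thesis using V(3) by (intro that) (rule subset_trans)
qed

lemma continuous_on_cylinder:
  fixes f :: "(nat \<Rightarrow> 'b::topological_space) \<Rightarrow> 'c::topological_space"
  assumes "continuous_on UNIV f" "open U" "f x \<in> U"
  obtains k where "f ` cylinder (map x [0..<k]) \<subseteq> U"
proof -
  have "open (f -` U)" using assms(2,1) by (rule open_vimage)
  moreover have "x \<in> f -` U" using assms(3) by simp
  ultimately obtain k where "cylinder (map x [0..<k]) \<subseteq> f -` U"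
    by (rule open_contains_cylinder)
  then show ?thesis by (intro that) (simp add: image_subset_iff_subset_vimage)
qed

section \<open>The Baire property of continuous images of Baire space\<close>

text \<open>The instance \<open>fun :: (countable, metric_space) metric_space\<close> of the library excludes an
  instance making \<^typ>\<open>nat \<Rightarrow> bool\<close> a \<^class>\<open>t2_space\<close>; hence the Hausdorff property is
  an explicit hypothesis below.\<close>

lemma Hausdorff_euclideanD:
  fixes x y :: "'b::topological_space"
  assumes "Hausdorff_space (euclidean :: 'b topology)" "x \<noteq> y"
  obtains U V where "open U" "open V" "x \<in> U" "y \<in> V" "U \<inter> V = {}"
proof -
  have "\<exists>U V. open U \<and> open V \<and> x \<in> U \<and> y \<in> V \<and> U \<inter> V = {}"
    using assms by (simp add: Hausdorff_space_def disjnt_def)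
  then show ?thesis by (elim exE conjE) (rule that)
qed

lemma Hausdorff_euclidean_fun:
  "Hausdorff_space (euclidean :: ('a \<Rightarrow> 'b::t2_space) topology)"
proof -
  have "Hausdorff_space (euclidean :: 'b topology)"
    unfolding Hausdorff_space_def disjnt_def open_openin[symmetric]
    by (intro allI impI hausdorff) simp
  then show ?thesis
    unfolding euclidean_product_topology[symmetric] Hausdorff_space_product_topology by simp
qed

text \<open>The hull \<open>E []\<close> of the range is closed, hence open up to a nowhere dense
  set, and it misses only a meager part of the range. The work is to show that it exceeds the range
  by a meager set.\<close>

theorem baire_property_range:
  fixes f :: "(nat \<Rightarrow> nat) \<Rightarrow> 'b::second_countable_topology"
  assumes T2: "Hausdorff_space (euclidean :: 'b topology)" and f: "continuous_on UNIV f"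
  shows "baire_property (range f)"
proof -
  define E where "E s = nonmeager_points (f ` cylinder s)" for s
  define G where "G s = (\<Union>n. interior (E (s @ [n])))" for s
  have closed_E: "closed (E s)" for s
    unfolding E_def by (rule closed_nonmeager_points)
  have meager_image: "meager (f ` cylinder s - E s)" for s
    unfolding E_def by (rule meager_diff_nonmeager_points)
  have meager_boundary: "meager (E s - interior (E s))" for s
    using closed_E by (intro meager_nowhere_dense nowhere_dense_closed_diff_interior)
  have nd: "nowhere_dense (E s - G s)" for s
  proof -
    have clo: "closed (E s - G s)"
      using closed_E unfolding G_def by (intro closed_Diff open_UN) auto
    define W where "W = interior (E s - G s)"
    \<comment> \<open>A point of the image lies in the image of some child \<open>s @ [n]\<close>.
      Being outside \<open>G s\<close>, it avoids the interior of that child's hull, so it falls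
      into one of two meager sets. Every point of \<open>W\<close> would have to be a nonmeager
      point of the image, so \<open>W\<close> is empty.\<close>
    have "f ` cylinder s \<inter> W \<subseteq>
        (\<Union>n. (f ` cylinder (s @ [n]) - E (s @ [n])) \<union> (E (s @ [n]) - interior (E (s @ [n]))))"
    proof
      fix y assume y: "y \<in> f ` cylinder s \<inter> W"
      then obtain n where "y \<in> f ` cylinder (s @ [n])" using cylinder_eq_UN[of s] by blast
      moreover have "y \<notin> interior (E (s @ [n]))"
        using y interior_subset unfolding W_def G_def by blast
      ultimately show "y \<in> (\<Union>n. (f ` cylinder (s @ [n]) - E (s @ [n])) \<union>
          (E (s @ [n]) - interior (E (s @ [n]))))" by blast
    qed
    moreover have "meager (\<Union>n. (f ` cylinder (s @ [n]) - E (s @ [n])) \<union>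
        (E (s @ [n]) - interior (E (s @ [n]))))"
      by (intro meager_UN meager_Un meager_image meager_boundary) auto
    ultimately have "meager (f ` cylinder s \<inter> W)" by (rule meager_subset[rotated])
    moreover have "W \<subseteq> E s" "open W" using interior_subset unfolding W_def by auto
    ultimately have "W = {}" unfolding E_def nonmeager_points_def by blast
    then show ?thesis using clo unfolding nowhere_dense_def W_def by simp
  qed
  \<comment> \<open>A point of \<open>E []\<close> outside \<open>M\<close> stays in \<open>E\<close> along some branch \<open>x\<close>, hence in the closures
    of the images of all cylinders around \<open>x\<close>, which forces it to be \<open>f x\<close>.\<close>
  define M where "M = (\<Union>s. E s - G s)"
  have "meager M"
    unfolding M_def using nd by (intro meager_UN meager_nowhere_dense) auto
  have "E [] - range f \<subseteq> M"
  proof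
    fix y assume y: "y \<in> E [] - range f"
    show "y \<in> M"
    proof (rule ccontr)
      assume "y \<notin> M"
      then have "\<exists>n. y \<in> E (s @ [n])" if "y \<in> E s" for s
        using that interior_subset unfolding M_def G_def by blast
      then obtain c where c: "\<And>s. y \<in> E s \<Longrightarrow> y \<in> E (s @ [c s])" by metis
      define u where "u = rec_nat [] (\<lambda>_ s. s @ [c s])"
      define x where "x n = c (u n)" for n
      have u: "u n = map x [0..<n]" for n
        by (induction n) (auto simp: u_def x_def)
      have yE: "y \<in> E (u n)" for n
        using y c by (induction n) (auto simp: u_def)
      have "f x \<noteq> y" using y by blast
      with T2 obtain U V where UV: "open U" "open V" "f x \<in> U" "y \<in> V" "U \<inter> V = {}"
        by (rule Hausdorff_euclideanD)
      obtain k where k: "f ` cylinder (map x [0..<k]) \<subseteq> U"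
        using continuous_on_cylinder[OF f UV(1,3)] .
      have "y \<in> closure (f ` cylinder (u k))"
        using yE nonmeager_points_subset_closure unfolding E_def by blast
      then show False using k u UV by (auto simp: closure_iff_nhds_not_empty) blast
    qed
  qed
  \<comment> \<open>The three errors are range points outside the hull, the boundary of the hull,
    and hull points missed by \<open>f\<close>.\<close>
  then have "sym_diff (range f) (interior (E [])) \<subseteq>
      (range f - E []) \<union> (E [] - interior (E [])) \<union> M"
    using interior_subset by blast
  moreover have "meager ((range f - E []) \<union> (E [] - interior (E [])) \<union> M)"
    using \<open>meager M\<close> meager_image[of "[]"] meager_boundary by (intro meager_Un) auto
  ultimately show ?thesis
    unfolding baire_property_def using meager_subset open_interior by blast
qed

section \<open>The perfect set property\<close>

text \<open>After the countable images of cylinders are discarded, two distinct values remain, and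
  every cylinder around their preimages has uncountable image. Disjoint neighbourhoods of the values
  and continuity give the two extensions.\<close>

lemma uncountable_image_cylinder_split:
  fixes f :: "(nat \<Rightarrow> nat) \<Rightarrow> 'b::topological_space"
  assumes T2: "Hausdorff_space (euclidean :: 'b topology)" and f: "continuous_on UNIV f"
    and s: "uncountable (f ` cylinder s)"
  obtains t0 t1 where "t0 \<noteq> []" "t1 \<noteq> []"
    "uncountable (f ` cylinder (s @ t0))" "uncountable (f ` cylinder (s @ t1))"
    "f ` cylinder (s @ t0) \<inter> f ` cylinder (s @ t1) = {}"
proof -
  define L where "L = (\<Union>t\<in>{t. countable (f ` cylinder t)}. f ` cylinder t)"
  \<comment> \<open>There are only countably many finite sequences of naturals.\<close>
  have "countable L" unfolding L_def by (intro countable_UN) auto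
  then have unc: "uncountable (f ` cylinder s - L)"
    using s by (simp add: uncountable_minus_countable)
  then obtain y0 where y0: "y0 \<in> f ` cylinder s - L"
    by (metis countable_empty equals0I)
  have "uncountable (f ` cylinder s - L - {y0})"
    using unc by (simp add: uncountable_minus_countable)
  then obtain y1 where y1: "y1 \<in> f ` cylinder s - L" "y1 \<noteq> y0"
    by (metis countable_empty equals0I DiffE singletonI)
  obtain x0 x1 where x: "x0 \<in> cylinder s" "x1 \<in> cylinder s" "y0 = f x0" "y1 = f x1"
    using y0 y1 by blast
  have big: "uncountable (f ` cylinder (map z [0..<k]))" if "f z \<notin> L" for z k
    using that unfolding L_def by (force simp: mem_cylinder_map_iff)
  have "f x0 \<noteq> f x1" using y1(2) x by simp
  with T2 obtain U V where UV: "open U" "open V" "f x0 \<in> U" "f x1 \<in> V" "U \<inter> V = {}"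
    by (rule Hausdorff_euclideanD)
  have ext: "\<exists>t. t \<noteq> [] \<and> uncountable (f ` cylinder (s @ t)) \<and> f ` cylinder (s @ t) \<subseteq> W"
    if z: "z \<in> cylinder s" "f z \<notin> L" and W: "open W" "f z \<in> W" for z W
  proof -
    obtain k where k: "f ` cylinder (map z [0..<k]) \<subseteq> W"
      using continuous_on_cylinder[OF f W] .
    \<comment> \<open>\<open>Suc k\<close> in place of \<open>k\<close> keeps \<open>t\<close>
      nonempty; the segment \<open>s @ t\<close> still covers the first \<open>k\<close>
      coordinates.\<close>
    define t where "t = map z [length s..<length s + Suc k]"
    have st: "s @ t = map z [0..<length s + Suc k]"
      using z(1) upt_add_eq_append[of 0 "length s" "Suc k"]
      by (simp add: t_def cylinder_def)
    have "cylinder (s @ t) \<subseteq> cylinder (map z [0..<k])"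
      unfolding st by (auto simp only: mem_cylinder_map_iff)
    moreover have "t \<noteq> []" by (simp add: t_def)
    moreover have "uncountable (f ` cylinder (s @ t))" unfolding st by (rule big[OF z(2)])
    ultimately show ?thesis using k by blast
  qed
  obtain t0 where t0: "t0 \<noteq> []" "uncountable (f ` cylinder (s @ t0))"
      "f ` cylinder (s @ t0) \<subseteq> U"
    using ext[of x0 U] x y0 UV by blast
  obtain t1 where t1: "t1 \<noteq> []" "uncountable (f ` cylinder (s @ t1))"
      "f ` cylinder (s @ t1) \<subseteq> V"
    using ext[of x1 V] x y1 UV by blast
  have "f ` cylinder (s @ t0) \<inter> f ` cylinder (s @ t1) = {}"
    using t0(3) t1(3) UV(5) by blast
  then show ?thesis using that t0 t1 by blast
qed

text \<open>Iterated splitting gives a Cantor scheme whose branches have pairwise different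
  images.\<close>

theorem uncountable_range_lepoll:
  fixes f :: "(nat \<Rightarrow> nat) \<Rightarrow> 'b::topological_space"
  assumes T2: "Hausdorff_space (euclidean :: 'b topology)" and f: "continuous_on UNIV f"
    and unc: "uncountable (range f)"
  shows "(UNIV :: (nat \<Rightarrow> bool) set) \<lesssim> range f"
proof -
  define big where "big s \<longleftrightarrow> uncountable (f ` cylinder s)" for s
  have "\<exists>t :: bool \<Rightarrow> nat list. (\<forall>b. t b \<noteq> [] \<and> big (s @ t b)) \<and>
      f ` cylinder (s @ t False) \<inter> f ` cylinder (s @ t True) = {}" if s: "big s" for s
  proof -
    obtain t0 t1 where "t0 \<noteq> []" "t1 \<noteq> []" "big (s @ t0)" "big (s @ t1)"
      "f ` cylinder (s @ t0) \<inter> f ` cylinder (s @ t1) = {}"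
      using uncountable_image_cylinder_split[OF T2 f] s unfolding big_def by blast
    then show ?thesis by (intro exI[of _ "\<lambda>b. if b then t1 else t0"]) auto
  qed
  then obtain t :: "nat list \<Rightarrow> bool \<Rightarrow> nat list" where
    t: "\<And>s b. big s \<Longrightarrow> t s b \<noteq> []" "\<And>s b. big s \<Longrightarrow> big (s @ t s b)"
       "\<And>s. big s \<Longrightarrow> f ` cylinder (s @ t s False) \<inter> f ` cylinder (s @ t s True) = {}"
    by metis
  \<comment> \<open>\<open>u z n\<close> is the node reached after \<open>n\<close> binary choices.
    Its length is at least \<open>n\<close> but may be larger, as a split can append several
    entries.\<close>
  define u where "u z = rec_nat [] (\<lambda>n s. s @ t s (z n))" for z :: "nat \<Rightarrow> bool"
  have u_Suc: "u z (Suc n) = u z n @ t (u z n) (z n)" and u_0: "u z 0 = []" for z n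
    by (simp_all add: u_def)
  have big_u: "big (u z n)" for z n
    using unc by (induction n) (simp_all add: u_0 u_Suc t(2), simp add: big_def)
  have len_u: "n \<le> length (u z n)" for z n
  proof (induction n)
    case (Suc n)
    have "length (t (u z n) (z n)) > 0" using t(1)[OF big_u] by simp
    then show ?case using Suc unfolding u_Suc length_append by linarith
  qed simp
  have u_ext: "\<exists>r. u z n = u z m @ r" if "m \<le> n" for z m n
    using that by (induction rule: dec_induct) (auto simp: u_Suc)
  \<comment> \<open>Stage \<open>Suc i\<close> has length at least \<open>Suc i\<close>, so entry
    \<open>i\<close> exists there; later stages only extend it.\<close>
  define x where "x z i = u z (Suc i) ! i" for z i
  have x_cyl: "x z \<in> cylinder (u z n)" for z n
    unfolding mem_cylinder_iff
  proof (intro allI impI)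
    fix i assume i: "i < length (u z n)"
    have "i < length (u z (Suc i))" using len_u[of "Suc i" z] by linarith
    then show "x z i = u z n ! i"
      using i u_ext[of "Suc i" n z] u_ext[of n "Suc i" z] unfolding x_def
      by (cases "Suc i \<le> n") (auto simp: nth_append)
  qed
  have "inj (\<lambda>z. f (x z))"
  proof (rule injI, rule ccontr)
    fix z w assume eq: "f (x z) = f (x w)" and "z \<noteq> w"
    then have "\<exists>n. z n \<noteq> w n" by auto
    \<comment> \<open>Up to the first disagreement the two branches pass through the same nodes;
      there they take opposite children, whose images are disjoint.\<close>
    define n where "n = (LEAST n. z n \<noteq> w n)"
    have n: "z n \<noteq> w n" and less: "\<And>m. m < n \<Longrightarrow> z m = w m"
      using LeastI_ex[OF \<open>\<exists>n. z n \<noteq> w n\<close>] not_less_Least unfolding n_def by blast+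
    have "m \<le> n \<Longrightarrow> u z m = u w m" for m
      using less by (induction m) (auto simp: u_0 u_Suc)
    then have uw: "u w n = u z n" by simp
    have "f (x z) \<in> f ` cylinder (u z n @ t (u z n) (z n))"
         "f (x w) \<in> f ` cylinder (u z n @ t (u z n) (w n))"
      using x_cyl[of z "Suc n"] x_cyl[of w "Suc n"] uw by (auto simp: u_Suc)
    then show False using eq n t(3)[OF big_u[of z n]] by (cases "z n"; cases "w n") auto
  qed
  then show ?thesis unfolding lepoll_def by blast
qed

section \<open>Analytic subsets of the Cantor space\<close>

lemma closed_retract_baire_space:
  fixes C :: "(nat \<Rightarrow> nat) set"
  assumes "closed C" "C \<noteq> {}"
  obtains r :: "(nat \<Rightarrow> nat) \<Rightarrow> nat \<Rightarrow> nat" where "continuous_on UNIV r" "range r = C"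
proof -
  define Z where "Z x k = cylinder (map x [0..<k])" for x :: "nat \<Rightarrow> nat" and k
  have Z_cong: "Z y j = Z x j" if "y \<in> Z x k" "j \<le> k" for x y k j
    using that unfolding Z_def by (auto simp: mem_cylinder_map_iff)
  have Z_mono: "Z x k \<subseteq> Z x j" if "j \<le> k" for x j k
    using that unfolding Z_def by (auto simp: mem_cylinder_map_iff)
  have Z_self: "x \<in> Z x k" for x k unfolding Z_def by (simp add: mem_cylinder_map_iff)
  \<comment> \<open>The shift by \<open>Suc\<close> makes \<open>lev x\<close> the last length at
    which the cylinder still meets \<open>C\<close>; length \<open>0\<close> always qualifies
    because \<open>C\<close> is nonempty.\<close>
  have out: "\<exists>k. Z x (Suc k) \<inter> C = {}" if "x \<notin> C" for x
  proof -
    have "open (- C)" "x \<in> - C" using assms(1) that by auto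
    then obtain k where "Z x k \<subseteq> - C"
      unfolding Z_def by (rule open_contains_cylinder)
    then show ?thesis using Z_mono[of k "Suc k" x] by auto
  qed
  \<comment> \<open>A point outside \<open>C\<close> is sent to a chosen point of \<open>C\<close> sharing with it a longest possible
    initial segment.\<close>
  define lev where "lev x = (LEAST k. Z x (Suc k) \<inter> C = {})" for x
  define r where "r x = (if x \<in> C then x else SOME y. y \<in> Z x (lev x) \<inter> C)" for x
  have lev: "Z x (Suc (lev x)) \<inter> C = {}" if "x \<notin> C" for x
    unfolding lev_def using out[OF that] by (rule LeastI_ex)
  have meet: "Z x k \<inter> C \<noteq> {}" if "k \<le> lev x" for x k
  proof (cases k)
    case 0
    then show ?thesis using assms(2) by (simp add: Z_def)
  next
    case (Suc j)
    then have "j < lev x" using that by simp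
    then show ?thesis using Suc unfolding lev_def by (auto dest: not_less_Least)
  qed
  have r_out: "r x \<in> Z x (lev x) \<inter> C" if "x \<notin> C" for x
    using some_in_eq[THEN iffD2, OF meet[of "lev x" x]] that unfolding r_def by simp
  have r_near: "r x \<in> Z x k" if "Z x k \<inter> C \<noteq> {}" for x k
  proof (cases "x \<in> C")
    case False
    have "k \<le> lev x"
    proof (rule ccontr)
      assume "\<not> k \<le> lev x"
      then have "Z x k \<subseteq> Z x (Suc (lev x))" by (intro Z_mono) simp
      then show False using lev[OF False] that by blast
    qed
    then show ?thesis using r_out[OF False] Z_mono[of k "lev x" x] by blast
  next
    case True
    then show ?thesis using Z_self by (simp add: r_def)
  qed
  have "continuous_on UNIV r"
    unfolding continuous_on_open_vimage[OF open_UNIV]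
  proof (intro allI impI, subst open_subopen, intro ballI)
    fix U x assume U: "open U" and "x \<in> r -` U \<inter> UNIV"
    then have x: "r x \<in> U" by simp
    show "\<exists>T. open T \<and> x \<in> T \<and> T \<subseteq> r -` U \<inter> UNIV"
    proof (cases "x \<in> C")
      case True
      then obtain k where k: "Z x k \<subseteq> U"
        using open_contains_cylinder[OF U] x unfolding r_def Z_def by metis
      \<comment> \<open>At a point of \<open>C\<close> every surrounding cylinder meets
        \<open>C\<close>, so \<open>r\<close> maps it into itself.\<close>
      have "r y \<in> U" if y: "y \<in> Z x k" for y
      proof -
        have "Z y k = Z x k" using Z_cong[OF y] by blast
        moreover have "Z x k \<inter> C \<noteq> {}" using True Z_self by blast
        ultimately show ?thesis using r_near[of y k] k by blast
      qed
      then show ?thesis using Z_self open_cylinder unfolding Z_def by blast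
    next
      case False
      \<comment> \<open>Off \<open>C\<close> the level and the set of candidates depend only on the
        first \<open>Suc (lev x)\<close> coordinates, so \<open>r\<close> is locally
        constant.\<close>
      have "r y = r x" if y: "y \<in> Z x (Suc (lev x))" for y
      proof -
        have Zy: "Z y j = Z x j" if "j \<le> Suc (lev x)" for j using Z_cong[OF y that] .
        have "y \<notin> C" using lev[OF False] y by blast
        have "lev y = lev x"
          unfolding lev_def[of y]
        proof (rule Least_equality)
          show "Z y (Suc (lev x)) \<inter> C = {}" using Zy lev[OF False] by simp
          fix j assume "Z y (Suc j) \<inter> C = {}"
          then show "lev x \<le> j" using Zy[of "Suc j"] meet[of "Suc j" x]
            by (metis Suc_leI le_SucI not_le_imp_less)
        qed
        then show ?thesis using Zy[of "lev x"] False \<open>y \<notin> C\<close> by (simp add: r_def)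
      qed
      then show ?thesis using Z_self open_cylinder x unfolding Z_def by blast
    qed
  qed
  moreover have "range r = C"
  proof
    show "range r \<subseteq> C" using r_out by (force simp: r_def[of x for x])
    show "C \<subseteq> range r" unfolding r_def by (auto simp: image_iff)
  qed
  ultimately show ?thesis using that by blast
qed

text \<open>Composing \<open>g\<close> with a continuous map of Baire space onto \<open>C\<close>
  makes the image a range; an empty \<open>C\<close> falls under the separate clause of
  \<open>analytic_set\<close>.\<close>

lemma analytic_set_closed_image:
  fixes C :: "(nat \<Rightarrow> nat) set"
  assumes "closed C" "continuous_on UNIV g"
  shows "analytic_set (g ` C)"
proof (cases "C = {}")
  case False
  with assms(1) obtain r :: "(nat \<Rightarrow> nat) \<Rightarrow> nat \<Rightarrow> nat"
    where r: "continuous_on UNIV r" "range r = C"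
    by (rule closed_retract_baire_space)
  have "continuous_on UNIV (\<lambda>x. g (r x))"
    using continuous_on_compose2[OF assms(2) r(1)] by simp
  moreover have "g ` C = range (\<lambda>x. g (r x))" using r(2) by auto
  ultimately show ?thesis unfolding analytic_set_def by blast
qed (simp add: analytic_set_def)

lemma analytic_set_baire_property:
  assumes "analytic_set S"
  shows "baire_property S"
proof (cases "S = {}")
  case True
  moreover have "meager ({} :: cantor set)" by (rule meager_subset_Union[of "{}"]) auto
  ultimately show ?thesis unfolding baire_property_def by (intro exI[of _ "{}"]) auto
next
  case False
  then obtain f :: "(nat \<Rightarrow> nat) \<Rightarrow> cantor" where "continuous_on UNIV f" "S = range f"
    using assms unfolding analytic_set_def by auto
  then show ?thesis using baire_property_range[OF Hausdorff_euclidean_fun, of f] by simp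
qed

lemma UNIV_cantor_eqpoll_real: "(UNIV :: cantor set) \<approx> (UNIV :: real set)"
proof -
  have "bij (Collect :: cantor \<Rightarrow> nat set)"
    by (rule bij_betw_byWitness[where f' = "\<lambda>A n. n \<in> A"]) auto
  then have "(UNIV :: cantor set) \<approx> (UNIV :: nat set set)"
    unfolding eqpoll_def by blast
  then show ?thesis using nat_sets_eqpoll_reals eqpoll_trans by blast
qed

lemma analytic_set_countable_or_continuum:
  assumes "analytic_set S"
  shows "countable S \<or> S \<approx> (UNIV :: real set)"
proof (intro disjCI)
  assume "\<not> S \<approx> (UNIV :: real set)"
  show "countable S"
  proof (rule ccontr)
    assume "uncountable S"
    then obtain f :: "(nat \<Rightarrow> nat) \<Rightarrow> cantor" where "continuous_on UNIV f" "S = range f"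
      using assms unfolding analytic_set_def by auto
    then have "(UNIV :: cantor set) \<lesssim> S"
      using uncountable_range_lepoll[OF Hausdorff_euclidean_fun, of f] \<open>uncountable S\<close> by simp
    \<comment> \<open>Schroeder-Bernstein, since \<open>S\<close> is itself a subset of the Cantor
      space.\<close>
    then have "S \<approx> (UNIV :: cantor set)"
      by (intro lepoll_antisym) (auto intro: subset_imp_lepoll)
    then show False
      using \<open>\<not> S \<approx> UNIV\<close> UNIV_cantor_eqpoll_real eqpoll_trans by blast
  qed
qed

section \<open>Copies as ranges of self-embeddings\<close>

text \<open>Embeddings are transported along \<open>e\<close> to maps on \<open>nat\<close>, so that
  they become points of Baire space.\<close>

definition self_embeddings :: "('i, 'a) relstruct \<Rightarrow> (nat \<Rightarrow> 'a) \<Rightarrow> (nat \<Rightarrow> nat) set" where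
  "self_embeddings \<X> e = {h. inj h \<and> (\<forall>i\<in>index_of \<X>. \<forall>t. length t = arity_of \<X> i \<longrightarrow>
     (map e t \<in> rel_of \<X> i \<longleftrightarrow> map e (map h t) \<in> rel_of \<X> i))}"

lemma id_self_embedding: "id \<in> self_embeddings \<X> e"
  by (simp add: self_embeddings_def)

lemma comp_self_embedding:
  assumes "g \<in> self_embeddings \<X> e" "h \<in> self_embeddings \<X> e"
  shows "g \<circ> h \<in> self_embeddings \<X> e"
proof -
  have "inj (g \<circ> h)"
    using assms by (intro inj_compose) (auto simp: self_embeddings_def)
  moreover have "map e t \<in> rel_of \<X> i \<longleftrightarrow> map e (map (g \<circ> h) t) \<in> rel_of \<X> i"
    if "i \<in> index_of \<X>" "length t = arity_of \<X> i" for i t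
  proof -
    have "map e t \<in> rel_of \<X> i \<longleftrightarrow> map e (map h t) \<in> rel_of \<X> i"
      using assms(2) that by (simp add: self_embeddings_def)
    also have "\<dots> \<longleftrightarrow> map e (map g (map h t)) \<in> rel_of \<X> i"
      using assms(1) that unfolding self_embeddings_def
      by (metis (mono_tags, lifting) length_map mem_Collect_eq)
    finally show ?thesis by simp
  qed
  ultimately show ?thesis unfolding self_embeddings_def by blast
qed

text \<open>\<open>isomorphic\<close> provides a map from the copy onto the whole structure; its
  inverse is an embedding whose range is the copy, and conversely.\<close>

lemma copies_iff_self_embedding:
  assumes e: "bij_betw e UNIV (dom_of \<X>)"
  shows "A \<in> copies \<X> \<longleftrightarrow> (\<exists>h\<in>self_embeddings \<X> e. A = range (e \<circ> h))"
proof
  assume "A \<in> copies \<X>"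
  then obtain f where A: "A \<subseteq> dom_of \<X>" and f: "bij_betw f A (dom_of \<X>)"
    and f_rel: "\<And>i t. i \<in> index_of \<X> \<Longrightarrow> t \<in> tuples (arity_of \<X> i) A \<Longrightarrow>
      t \<in> rel_of \<X> i \<longleftrightarrow> map f t \<in> rel_of \<X> i"
    by (auto simp: copies_def isomorphic_def substructure_def)
  define g where "g = inv_into A f \<circ> e"
  have g: "bij_betw g UNIV A"
    unfolding g_def using e bij_betw_inv_into[OF f] by (rule bij_betw_trans)
  define h where "h = inv e \<circ> g"
  have eh: "e \<circ> h = g"
  proof
    fix m
    have "g m \<in> range e" using bij_betwE[OF g] A e by (auto simp: bij_betw_def)
    then show "(e \<circ> h) m = g m" by (simp add: h_def f_inv_into_f)
  qed
  have "inj h" using g eh by (metis bij_betw_def inj_on_imageI2)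
  moreover have "map e t \<in> rel_of \<X> i \<longleftrightarrow> map e (map h t) \<in> rel_of \<X> i"
    if "i \<in> index_of \<X>" "length t = arity_of \<X> i" for i t
  proof -
    have "f (g m) = e m" for m
      using f bij_betwE[OF e] by (simp add: g_def bij_betw_inv_into_right)
    then have "map f (map g t) = map e t" by simp
    moreover have "map g t \<in> tuples (arity_of \<X> i) A"
      using that(2) bij_betwE[OF g] by (auto simp: tuples_def)
    moreover have "map e (map h t) = map g t" by (simp add: eh)
    ultimately show ?thesis using f_rel[OF that(1)] by metis
  qed
  ultimately have "h \<in> self_embeddings \<X> e" unfolding self_embeddings_def by blast
  moreover have "A = range (e \<circ> h)" using g eh by (simp add: bij_betw_def)
  ultimately show "\<exists>h\<in>self_embeddings \<X> e. A = range (e \<circ> h)" by blast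
next
  assume "\<exists>h\<in>self_embeddings \<X> e. A = range (e \<circ> h)"
  then obtain h where h: "h \<in> self_embeddings \<X> e" and A: "A = range (e \<circ> h)" by blast
  have "inj (e \<circ> h)"
    using h e by (intro inj_compose) (auto simp: self_embeddings_def bij_betw_def)
  then have g: "bij_betw (e \<circ> h) UNIV A" using A by (simp add: bij_betw_def)
  define f where "f = e \<circ> inv (e \<circ> h)"
  have "bij_betw f A (dom_of \<X>)"
    unfolding f_def using bij_betw_inv_into[OF g] e by (rule bij_betw_trans)
  moreover have "t \<in> rel_of \<X> i \<longleftrightarrow> map f t \<in> rel_of \<X> i"
    if "i \<in> index_of \<X>" "t \<in> tuples (arity_of \<X> i) A" for i t
  proof -
    define s where "s = map (inv (e \<circ> h)) t"
    have "length s = arity_of \<X> i" using that(2) by (simp add: s_def tuples_def)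
    then have "map e s \<in> rel_of \<X> i \<longleftrightarrow> map e (map h s) \<in> rel_of \<X> i"
      using h that(1) by (simp add: self_embeddings_def)
    moreover have "map f t = map e s" by (simp add: s_def f_def)
    moreover have "map e (map h s) = map (\<lambda>x. (e \<circ> h) (inv (e \<circ> h) x)) t"
      by (simp add: s_def)
    \<comment> \<open>The entries of \<open>t\<close> lie in \<open>A\<close>, the range of
      \<open>e \<circ> h\<close>, where the inverse is a right inverse.\<close>
    moreover have "\<dots> = map (\<lambda>x. x) t"
      using that(2) A by (intro map_cong refl f_inv_into_f) (auto simp: tuples_def)
    ultimately show ?thesis by simp
  qed
  moreover have "A \<subseteq> dom_of \<X>" using A e by (auto simp: bij_betw_def)
  ultimately show "A \<in> copies \<X>"
    unfolding copies_def isomorphic_def substructure_def by (auto intro!: exI[of _ f])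
qed

text \<open>The embedding \<open>h\<close> with range \<open>A\<close> misses a point
  \<open>p\<close>, and then the ranges of its iterates are pairwise distinct.\<close>

lemma infinite_copies:
  fixes e :: "nat \<Rightarrow> 'a"
  assumes e: "bij_betw e UNIV (dom_of \<X>)"
    and A: "A \<in> copies \<X>" "A \<noteq> dom_of \<X>"
  shows "infinite (copies \<X>)"
proof -
  obtain h where h: "h \<in> self_embeddings \<X> e" and A_eq: "A = range (e \<circ> h)"
    using A(1) copies_iff_self_embedding[OF e] by blast
  have inj_h: "inj h" using h by (simp add: self_embeddings_def)
  have inj_e: "inj e" and range_e: "range e = dom_of \<X>" using e by (auto simp: bij_betw_def)
  obtain p where p: "p \<notin> range h"
  proof (cases "range h = UNIV")
    case True
    then have "A = range e" unfolding A_eq image_comp[symmetric] by simp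
    then show ?thesis using A(2) range_e by simp
  qed (use that in blast)
  have emb: "h ^^ n \<in> self_embeddings \<X> e" for n
    by (induction n) (simp_all only: funpow.simps id_self_embedding comp_self_embedding[OF h])
  define S where "S n = range (e \<circ> (h ^^ n))" for n
  have S_copy: "S n \<in> copies \<X>" for n
    unfolding S_def using copies_iff_self_embedding[OF e] emb by blast
  have S_neq: "S m \<noteq> S n" if "m < n" for m n
  proof
    assume "S m = S n"
    then have "e ((h ^^ m) p) \<in> S n" unfolding S_def by auto
    then obtain q where "e ((h ^^ m) p) = e ((h ^^ n) q)" unfolding S_def by auto
    then have "(h ^^ m) p = (h ^^ n) q" using inj_e by (simp add: inj_eq)
    \<comment> \<open>Cancelling the injective \<open>h ^^ m\<close> leaves at least one application
      of \<open>h\<close>, which puts \<open>p\<close> into its range.\<close>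
    moreover have "n = m + Suc (n - Suc m)" using that by simp
    ultimately have "(h ^^ m) p = (h ^^ m) ((h ^^ Suc (n - Suc m)) q)"
      by (metis comp_apply funpow_add)
    moreover have "inj (h ^^ m)" using emb by (simp add: self_embeddings_def)
    ultimately have "p = h ((h ^^ (n - Suc m)) q)" by (simp add: inj_eq)
    then show False using p by blast
  qed
  have "inj S" by (rule injI) (metis S_neq linorder_neqE_nat)
  then have "infinite (range S)" by (simp add: finite_image_iff)
  then show ?thesis using S_copy by (meson finite_subset image_subsetI)
qed

section \<open>Families of subsets and their characteristic functions\<close>

lemma char_fun_inj_on:
  assumes "bij_betw e UNIV X"
  shows "inj_on (char_fun e) (Pow X)"
proof (rule inj_onI)
  fix A B assume AB: "A \<in> Pow X" "B \<in> Pow X" and "char_fun e A = char_fun e B"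
  then have "e n \<in> A \<longleftrightarrow> e n \<in> B" for n by (metis char_fun_def)
  moreover have "range e = X" using assms by (simp add: bij_betw_def)
  ultimately show "A = B" using AB by blast
qed

lemma char_fun_surj:
  assumes "bij_betw e UNIV X"
  shows "char_fun e ` Pow X = UNIV"
proof -
  have "c = char_fun e (e ` {n. c n})" for c
    using assms by (auto simp: char_fun_def bij_betw_def inj_image_mem_iff)
  moreover have "e ` {n. c n} \<in> Pow X" for c using assms by (auto simp: bij_betw_def)
  ultimately show ?thesis by (metis UNIV_eq_I image_eqI)
qed

lemma char_family_eqpoll:
  assumes "bij_betw e UNIV X" "\<F> \<subseteq> Pow X"
  shows "char_family e \<F> \<approx> \<F>"
  unfolding char_family_def
  by (rule inj_on_image_eqpoll_self[OF inj_on_subset[OF char_fun_inj_on[OF assms(1)] assms(2)]])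

section \<open>Closed sets of codes for copies and their supersets\<close>

text \<open>A point of Baire space codes a pair: its even entries are a map \<open>h\<close>, its odd entries
  code a subset of \<open>\<omega>\<close> (entry \<open>0\<close> meaning non-membership).\<close>

definition even_part :: "(nat \<Rightarrow> nat) \<Rightarrow> nat \<Rightarrow> nat" where
  "even_part x n = x (2 * n)"

definition odd_support :: "(nat \<Rightarrow> nat) \<Rightarrow> cantor" where
  "odd_support x n = (x (2 * n + 1) \<noteq> 0)"

definition interleave :: "(nat \<Rightarrow> nat) \<Rightarrow> (nat \<Rightarrow> nat) \<Rightarrow> nat \<Rightarrow> nat" where
  "interleave h w n = (if even n then h (n div 2) else w (n div 2))"

lemma interleave_simps:
  "even_part (interleave h w) = h"
  "interleave h w (2 * n + 1) = w n"
  "interleave h w (2 * n) = h n"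
  by (auto simp: even_part_def interleave_def)

lemma continuous_on_odd_support: "continuous_on UNIV odd_support"
proof (rule continuous_on_coordinatewise_then_product)
  fix n
  have "open ((\<lambda>x. odd_support x n) -` B)" for B
    using open_map_Collect[of "\<lambda>l. (l ! 0 > 0) \<in> B" "[2 * n + 1]"]
    by (simp add: odd_support_def vimage_def)
  then show "continuous_on UNIV (\<lambda>x. odd_support x n)"
    by (simp add: continuous_on_open_vimage)
qed

lemma closed_even_part_self_embeddings: "closed {x. even_part x \<in> self_embeddings \<X> e}"
proof -
  \<comment> \<open>Arities are finite, so each condition reads finitely many even coordinates. The
    intersection may be taken over an uncountable index set without losing closedness.\<close>
  have "{x. even_part x \<in> self_embeddings \<X> e} =
      (\<Inter>m. \<Inter>n. {x. (\<lambda>l. l ! 0 = l ! 1 \<longrightarrow> m = n) (map x [2 * m, 2 * n])}) \<inter>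
      (\<Inter>i\<in>index_of \<X>. \<Inter>t\<in>{t. length t = arity_of \<X> i}.
        {x. (\<lambda>l. map e t \<in> rel_of \<X> i \<longleftrightarrow> map e l \<in> rel_of \<X> i) (map x (map ((*) 2) t))})"
    by (auto simp: self_embeddings_def even_part_def inj_def o_def)
  also have "closed \<dots>"
    by (intro closed_Int closed_INT ballI closed_map_Collect)
  finally show ?thesis .
qed

text \<open>A zero entry bars \<open>n\<close> from the range of \<open>h\<close>, so the coded set
  contains that range. The condition is universal over pairs of coordinates, hence closed.\<close>

definition up_codes :: "('i, 'a) relstruct \<Rightarrow> (nat \<Rightarrow> 'a) \<Rightarrow> (nat \<Rightarrow> nat) set" where
  "up_codes \<X> e = {x. even_part x \<in> self_embeddings \<X> e} \<inter>
     {x. \<forall>m n. x (2 * n + 1) = 0 \<longrightarrow> x (2 * m) \<noteq> n}"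

text \<open>Here a nonzero odd entry also records the preimage of \<open>n\<close> under \<open>h\<close>; without this
  record, being the range of \<open>h\<close> would not be a closed condition.\<close>

definition copy_codes :: "('i, 'a) relstruct \<Rightarrow> (nat \<Rightarrow> 'a) \<Rightarrow> (nat \<Rightarrow> nat) set" where
  "copy_codes \<X> e = up_codes \<X> e \<inter> {x. \<forall>m n. x (2 * n + 1) = Suc m \<longrightarrow> x (2 * m) = n}"

lemma closed_up_codes: "closed (up_codes \<X> e)"
proof -
  have "{x :: nat \<Rightarrow> nat. \<forall>m n. x (2 * n + 1) = 0 \<longrightarrow> x (2 * m) \<noteq> n} =
      (\<Inter>m. \<Inter>n. {x. (\<lambda>l. l ! 0 = 0 \<longrightarrow> l ! 1 \<noteq> n) (map x [2 * n + 1, 2 * m])})"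
    by auto
  also have "closed \<dots>" by (intro closed_INT ballI closed_map_Collect)
  finally show ?thesis
    unfolding up_codes_def by (intro closed_Int closed_even_part_self_embeddings)
qed

lemma closed_copy_codes: "closed (copy_codes \<X> e)"
proof -
  have "{x :: nat \<Rightarrow> nat. \<forall>m n. x (2 * n + 1) = Suc m \<longrightarrow> x (2 * m) = n} =
      (\<Inter>m. \<Inter>n. {x. (\<lambda>l. l ! 0 = Suc m \<longrightarrow> l ! 1 = n) (map x [2 * n + 1, 2 * m])})"
    by auto
  also have "closed \<dots>" by (intro closed_INT ballI closed_map_Collect)
  finally show ?thesis
    unfolding copy_codes_def by (intro closed_Int closed_up_codes)
qed

lemma char_fun_range:
  assumes "inj e"
  shows "char_fun e (range (e \<circ> h)) = (\<lambda>n. n \<in> range h)"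
  using assms by (auto simp: char_fun_def inj_eq)

lemma char_family_copies:
  assumes e: "bij_betw e UNIV (dom_of \<X>)"
  shows "char_family e (copies \<X>) = odd_support ` copy_codes \<X> e"
proof -
  have inj_e: "inj e" using e by (simp add: bij_betw_def)
  have copies_eq: "copies \<X> = (\<lambda>h. range (e \<circ> h)) ` self_embeddings \<X> e"
    using copies_iff_self_embedding[OF e] by blast
  have "char_family e (copies \<X>) = (\<lambda>h n. n \<in> range h) ` self_embeddings \<X> e"
    unfolding char_family_def copies_eq image_image char_fun_range[OF inj_e] ..
  also have "\<dots> = odd_support ` copy_codes \<X> e"
  proof (intro equalityI image_subsetI)
    fix h assume h: "h \<in> self_embeddings \<X> e"
    \<comment> \<open>The preimage of \<open>n\<close> is shifted by \<open>Suc\<close> to reserve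
      \<open>0\<close> for points outside the range.\<close>
    define w where "w n = (if n \<in> range h then Suc (inv h n) else 0)" for n
    define x where "x = interleave h w"
    have x: "even_part x = h" "x (2 * n + 1) = w n" "x (2 * n) = h n" for n
      unfolding x_def by (rule interleave_simps)+
    have "x \<in> copy_codes \<X> e"
      unfolding copy_codes_def up_codes_def
      using h by (simp only: Int_iff mem_Collect_eq x) (auto simp: w_def f_inv_into_f)
    moreover have "odd_support x = (\<lambda>n. n \<in> range h)"
      unfolding odd_support_def x by (auto simp: w_def)
    ultimately show "(\<lambda>n. n \<in> range h) \<in> odd_support ` copy_codes \<X> e"
      by (metis imageI)
  next
    fix x assume x: "x \<in> copy_codes \<X> e"
    \<comment> \<open>A zero entry excludes \<open>n\<close> from the range by the condition in
      \<open>up_codes\<close>; a successor entry names a preimage of \<open>n\<close>.\<close>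
    have "odd_support x n \<longleftrightarrow> n \<in> range (even_part x)" for n
    proof (cases "x (2 * n + 1)")
      case 0
      then show ?thesis using x
        by (auto simp: copy_codes_def up_codes_def odd_support_def even_part_def)
    next
      case (Suc m)
      then have "even_part x m = n" using x by (simp add: copy_codes_def even_part_def)
      then show ?thesis using Suc by (auto simp: odd_support_def)
    qed
    then have "odd_support x = (\<lambda>n. n \<in> range (even_part x))" by (rule ext)
    moreover have "even_part x \<in> self_embeddings \<X> e"
      using x by (simp add: copy_codes_def up_codes_def)
    ultimately show "odd_support x \<in> (\<lambda>h n. n \<in> range h) ` self_embeddings \<X> e"
      by simp
  qed
  finally show ?thesis .
qed

lemma char_family_copies_up:
  assumes e: "bij_betw e UNIV (dom_of \<X>)"
  shows "char_family e (copies_up \<X>) = odd_support ` up_codes \<X> e"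
proof (intro equalityI subsetI)
  have inj_e: "inj e" and range_e: "range e = dom_of \<X>" using e by (auto simp: bij_betw_def)
  {
    fix c assume "c \<in> char_family e (copies_up \<X>)"
    then obtain A S where A: "c = char_fun e A" and "S \<in> copies \<X>" "S \<subseteq> A"
      unfolding char_family_def copies_up_def by blast
    then obtain h where h: "h \<in> self_embeddings \<X> e" and sub: "range (e \<circ> h) \<subseteq> A"
      using copies_iff_self_embedding[OF e, of S] by blast
    \<comment> \<open>A superset need not consist of values of \<open>h\<close>, so a bare mark
      \<open>1\<close> replaces the recorded preimage.\<close>
    define w where "w n = (if e n \<in> A then 1 else 0 :: nat)" for n
    define x where "x = interleave h w"
    have x: "even_part x = h" "x (2 * n + 1) = w n" "x (2 * n) = h n" for n
      unfolding x_def by (rule interleave_simps)+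
    have "x \<in> up_codes \<X> e"
      unfolding up_codes_def
      using h sub by (simp only: Int_iff mem_Collect_eq x) (auto simp: w_def)
    moreover have "odd_support x = c"
      unfolding odd_support_def x A char_fun_def by (auto simp: w_def)
    ultimately show "c \<in> odd_support ` up_codes \<X> e" by blast
  next
    fix c assume "c \<in> odd_support ` up_codes \<X> e"
    then obtain x where c: "c = odd_support x" and x: "x \<in> up_codes \<X> e" by blast
    define A where "A = e ` {n. c n}"
    have "c = char_fun e A"
      using inj_e by (auto simp: A_def char_fun_def inj_image_mem_iff)
    moreover have "odd_support x (even_part x m)" for m
      using x by (auto simp: up_codes_def odd_support_def even_part_def)
    then have "range (e \<circ> even_part x) \<subseteq> A"
      unfolding A_def c by auto
    moreover have "range (e \<circ> even_part x) \<in> copies \<X>"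
      using x copies_iff_self_embedding[OF e] by (auto simp: up_codes_def)
    moreover have "A \<subseteq> dom_of \<X>" using range_e by (auto simp: A_def)
    ultimately have "A \<in> copies_up \<X>" unfolding copies_up_def by blast
    then show "c \<in> char_family e (copies_up \<X>)"
      using \<open>c = char_fun e A\<close> by (simp add: char_family_def)
  }
qed

text \<open>The alternative for analytic sets passes to \<open>\<F>\<close> along the injective
  \<open>char_fun\<close>; \<open>fin\<close> leaves \<open>1\<close> as the only finite
  size.\<close>

lemma size_1_aleph0_or_continuumI:
  assumes e: "bij_betw e UNIV X" and sub: "\<F> \<subseteq> Pow X"
    and ana: "analytic_set (char_family e \<F>)"
    and fin: "X \<in> \<F>" "\<F> = {X} \<or> infinite \<F>"
  shows "size_1_aleph0_or_continuum \<F>"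
proof (cases "\<F> = {X}")
  case False
  then have inf: "infinite \<F>" using fin by blast
  have eq: "\<F> \<approx> char_family e \<F>" using char_family_eqpoll[OF e sub] eqpoll_sym by blast
  from analytic_set_countable_or_continuum[OF ana] show ?thesis
  proof
    assume "countable (char_family e \<F>)"
    then have "countable \<F>" using countable_eqpoll eq by blast
    then have "\<F> \<approx> (UNIV :: nat set)"
      using inf countable_infiniteE' eqpoll_def eqpoll_sym by metis
    then show ?thesis by (simp add: size_1_aleph0_or_continuum_def)
  next
    assume "char_family e \<F> \<approx> (UNIV :: real set)"
    then show ?thesis
      using eq eqpoll_trans unfolding size_1_aleph0_or_continuum_def by blast
  qed
qed (simp add: size_1_aleph0_or_continuum_def)

theorem theorem3p1:
  fixes \<X> :: "('i, 'a) relstruct" and e :: "nat \<Rightarrow> 'a"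
  assumes "relational_structure \<X>"
    and "dom_of \<X> \<approx> (UNIV :: nat set)"
    and "bij_betw e UNIV (dom_of \<X>)"
  shows "analytic_set (char_family e (copies \<X>)) \<and>
    analytic_set (char_family e (copies_up \<X>)) \<and>
    (coanalytic_set (char_family e (copy_free \<X>)) \<and>
       {F. F \<subseteq> dom_of \<X> \<and> finite F} \<subseteq> copy_free \<X>) \<and>
    (baire_property (char_family e (copies \<X>)) \<and>
       baire_property (char_family e (copies_up \<X>)) \<and>
       size_1_aleph0_or_continuum (copies \<X>) \<and>
       size_1_aleph0_or_continuum (copies_up \<X>))"
proof (intro conjI)
  note e = assms(3)
  have inf: "infinite (dom_of \<X>)"
    using assms(2) eqpoll_finite_iff by blast
  have range_e: "range e = dom_of \<X>" using e by (simp add: bij_betw_def)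
  have dom_copy: "dom_of \<X> \<in> copies \<X>"
    using copies_iff_self_embedding[OF e] id_self_embedding range_e by (metis comp_id)
  have copies_sub: "copies \<X> \<subseteq> Pow (dom_of \<X>)" by (auto simp: copies_def)
  have up_sub: "copies_up \<X> \<subseteq> Pow (dom_of \<X>)" by (auto simp: copies_up_def)
  have copies_up: "copies \<X> \<subseteq> copies_up \<X>" using copies_sub by (auto simp: copies_up_def)
  show ana: "analytic_set (char_family e (copies \<X>))"
    unfolding char_family_copies[OF e]
    by (intro analytic_set_closed_image closed_copy_codes continuous_on_odd_support)
  show ana_up: "analytic_set (char_family e (copies_up \<X>))"
    unfolding char_family_copies_up[OF e]
    by (intro analytic_set_closed_image closed_up_codes continuous_on_odd_support)
  \<comment> \<open>Since \<open>char_fun e\<close> is a bijection from the power set onto the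
    Cantor space, complements correspond and co-analyticity follows from the previous part.\<close>
  have "copy_free \<X> = Pow (dom_of \<X>) - copies_up \<X>"
    by (auto simp: copy_free_def copies_up_def)
  then have "char_family e (copy_free \<X>) = - char_family e (copies_up \<X>)"
    using inj_on_image_set_diff[OF char_fun_inj_on[OF e], of "Pow (dom_of \<X>)" "copies_up \<X>"]
      up_sub char_fun_surj[OF e]
    by (auto simp: char_family_def Compl_eq_Diff_UNIV)
  then show "coanalytic_set (char_family e (copy_free \<X>))"
    using ana_up by (simp add: coanalytic_set_def)
  have "infinite A" if "A \<in> copies \<X>" for A
    using that inf bij_betw_finite
    by (auto simp: copies_def isomorphic_def substructure_def)
  then show "{F. F \<subseteq> dom_of \<X> \<and> finite F} \<subseteq> copy_free \<X>"
    by (auto simp: copy_free_def dest: finite_subset)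
  show "baire_property (char_family e (copies \<X>))"
    using ana by (rule analytic_set_baire_property)
  show "baire_property (char_family e (copies_up \<X>))"
    using ana_up by (rule analytic_set_baire_property)
  have alt: "copies \<X> = {dom_of \<X>} \<or> infinite (copies \<X>)"
    using infinite_copies[OF e] dom_copy by blast
  show "size_1_aleph0_or_continuum (copies \<X>)"
    using size_1_aleph0_or_continuumI[OF e copies_sub ana dom_copy alt] .
  \<comment> \<open>If the domain is the only copy, it is the only subset of itself containing one;
    otherwise the copies are already infinite.\<close>
  have "copies_up \<X> = {dom_of \<X>} \<or> infinite (copies_up \<X>)"
  proof (cases "copies \<X> = {dom_of \<X>}")
    case True
    then show ?thesis using up_sub by (auto simp: copies_up_def)
  next
    case False
    then show ?thesis using alt copies_up finite_subset by blast
  qed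
  then show "size_1_aleph0_or_continuum (copies_up \<X>)"
    using size_1_aleph0_or_continuumI[OF e up_sub ana_up] copies_up dom_copy by blast
qed

end
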